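(* Let $p\ge 2$ and let $T=(t_p,\tau)$ be a Thue-Morse turtle curve such that $\alpha_T(\phi(0))=\zeta_q^k$, where $\phi$ is the morphism on $(\mathbb Z/p\mathbb Z)^*$ defined by $\phi(a)=\Vert_{j=0}^{p-1}(a+\overline j)$, and $k$ and $q\ge 2$ are coprime integers. Let $B=(z_{p,q},\kappa)$ be the absolute turtle curve whose interpreter function is $\kappa((x,y))=P_T(\phi(x))\,\zeta_q^{ky}$ for all $(x,y)\in\mathbb Z/p\mathbb Z\times\mathbb Z/q\mathbb Z$. Then $T\sim B$.
   Context: Notation: $\mathbb N=\{0,1,2,\dots\}$; $\mathbb S^1=\{z\in\mathbb C:|z|=1\}$; $\zeta_m=e^{2\pi i/m}$; $A^*$ is the set of finite words over $A$; $\Vert$ denotes concatenation. Turtle group: $\mathcal G=\mathbb C\times\mathbb S^1$ with $(z_1,u_1)+(z_2,u_2)=(z_1+u_1z_2,u_1u_2)$ (sums are taken in order from left to right, empty sum $(0,1)$), and projections $\pi_1(z,u)=z$, $\pi_2(z,u)=u$. Turtle curve: a pair $T=(\sigma,\tau)$ where $\sigma:\mathbb N\to A$ is a sequence over a finite alphabet $A$ and $\tau:A\to\mathcal G$ is any function (an interpreter function). It is also viewed as the sequence of points $T(n)=\pi_1\left(\sum_{i=0}^{n-1}\tau(\sigma(i))\right)\in\mathbb C$. For a word $w=a_1\cdots a_m\in A^*$ put $S_T(w)=\tau(a_1)+\cdots+\tau(a_m)$, $P_T(w)=\pi_1(S_T(w))$, $\alpha_T(w)=\pi_2(S_T(w))$.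 An absolute turtle curve is one with $\pi_2(\tau(a))=1$ for all $a\in A$; then $\tau$ is viewed as a map $A\to\mathbb C$ (a complex number $c$ standing for $(c,1)$). Sequences: for $p\ge2$, $t_p:\mathbb N\to\mathbb Z/p\mathbb Z$ is defined by $t_p(0)=0$ and $t_p(pm+s)=t_p(m)+\overline s$ for $m\in\mathbb N$, $0\le s<p$. A Thue-Morse turtle curve is a turtle curve of the form $(t_p,\tau)$. For $p,q\ge 2$, $z_{p,q}:\mathbb N\to\mathbb Z/p\mathbb Z\times\mathbb Z/q\mathbb Z$ is $z_{p,q}(n)=(t_p(n),\overline n)$. Similarity: turtle curves $T_1,T_2$ are similar, $T_1\sim T_2$, if there exist positive integers $k_1,k_2$ and $c\in\mathbb C^\times$ such that $c\cdot T_1(k_1n)=T_2(k_2n)$ for all $n\in\mathbb N$. *)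

theory Defs
  imports "HOL-Analysis.Analysis" "Berlekamp_Zassenhaus.Finite_Field"
begin

text \<open>The turtle group \<open>\<complex> \<times> S\<^sup>1\<close>, written additively although it is not commutative.\<close>

typedef turtle = "(UNIV :: complex set) \<times> (sphere 0 1 :: complex set)"
  morphisms turtle_pair Turtle
  by (rule exI[of _ "(0, 1)"]) simp

setup_lifting type_definition_turtle

lift_definition pi1 :: "turtle \<Rightarrow> complex" is fst .

lift_definition pi2 :: "turtle \<Rightarrow> complex" is snd .

lift_definition turtle_of_complex :: "complex \<Rightarrow> turtle" is "\<lambda>c. (c, 1)"
  by simp

instantiation turtle :: group_add
begin

lift_definition zero_turtle :: turtle is "(0, 1)"
  by simp

lift_definition plus_turtle :: "turtle \<Rightarrow> turtle \<Rightarrow> turtle"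
  is "\<lambda>(z1, u1) (z2, u2). (z1 + u1 * z2, u1 * u2)"
  by (auto simp: norm_mult)

lift_definition uminus_turtle :: "turtle \<Rightarrow> turtle"
  is "\<lambda>(z, u). (- (z / u), 1 / u)"
  by (auto simp: norm_divide)

definition minus_turtle :: "turtle \<Rightarrow> turtle \<Rightarrow> turtle" where
  "minus_turtle a b = a + - b"

instance
proof
  fix a b c :: turtle
  show "a + b + c = a + (b + c)"
    by transfer (auto simp: algebra_simps)
  show "0 + a = a"
    by transfer auto
  show "a + 0 = a"
    by transfer auto
  show "- a + a = 0"
    by transfer auto
  show "a + - b = a - b"
    by (simp add: minus_turtle_def)
qed

end

lemma pi_simps [simp]:
  "pi1 0 = 0" "pi2 0 = 1"
  "pi1 (a + b) = pi1 a + pi2 a * pi1 b" "pi2 (a + b) = pi2 a * pi2 b"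
  "pi1 (turtle_of_complex c) = c" "pi2 (turtle_of_complex c) = 1"
  by (transfer; auto)+

text \<open>A pair of a sequence over a finite alphabet (the type \<open>'a\<close>) and an interpreter function.\<close>

type_synonym 'a turtle_curve = "(nat \<Rightarrow> 'a) \<times> ('a \<Rightarrow> turtle)"

definition curve_point :: "'a::finite turtle_curve \<Rightarrow> nat \<Rightarrow> complex" where
  "curve_point T n = pi1 (\<Sum>i\<leftarrow>[0..<n]. snd T (fst T i))"

definition word_sum :: "'a::finite turtle_curve \<Rightarrow> 'a list \<Rightarrow> turtle" where
  "word_sum T w = (\<Sum>a\<leftarrow>w. snd T a)"

definition word_point :: "'a::finite turtle_curve \<Rightarrow> 'a list \<Rightarrow> complex" where
  "word_point T w = pi1 (word_sum T w)"

definition word_angle :: "'a::finite turtle_curve \<Rightarrow> 'a list \<Rightarrow> complex" where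
  "word_angle T w = pi2 (word_sum T w)"

definition absolute_curve :: "(nat \<Rightarrow> 'a::finite) \<Rightarrow> ('a \<Rightarrow> complex) \<Rightarrow> 'a turtle_curve" where
  "absolute_curve \<sigma> \<kappa> = (\<sigma>, \<lambda>a. turtle_of_complex (\<kappa> a))"

definition similar :: "'a::finite turtle_curve \<Rightarrow> 'b::finite turtle_curve \<Rightarrow> bool" where
  "similar T1 T2 \<longleftrightarrow> (\<exists>k1 k2 :: nat. \<exists>c :: complex. k1 > 0 \<and> k2 > 0 \<and> c \<noteq> 0 \<and>
     (\<forall>n. c * curve_point T1 (k1 * n) = curve_point T2 (k2 * n)))"

text \<open>\<open>\<int>/p\<int>\<close> is the type \<open>'p mod_ring\<close> with \<open>p = CARD('p)\<close>; the class
  \<open>nontriv\<close> says exactly that \<open>CARD('p) \<ge> 2\<close>.\<close>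

function thue_morse :: "nat \<Rightarrow> 'p::nontriv mod_ring" where
  "thue_morse n = (if n = 0 then 0
     else thue_morse (n div CARD('p)) + of_nat (n mod CARD('p)))"
  by auto
termination
  by (relation "Wellfounded.measure id") (auto intro!: div_less_dividend nontriv simp del: One_nat_def)

declare thue_morse.simps [simp del]

lemma thue_morse_0: "(thue_morse 0 :: 'p::nontriv mod_ring) = 0"
  by (simp add: thue_morse.simps)

lemma thue_morse_rec:
  assumes "s < CARD('p)"
  shows "(thue_morse (CARD('p) * m + s) :: 'p::nontriv mod_ring) = thue_morse m + of_nat s"
proof (cases "CARD('p) * m + s = 0")
  case True
  then show ?thesis by (simp add: thue_morse_0)
next
  case False
  then have "(thue_morse (CARD('p) * m + s) :: 'p mod_ring) =
      thue_morse ((CARD('p) * m + s) div CARD('p)) + of_nat ((CARD('p) * m + s) mod CARD('p))"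
    by (subst thue_morse.simps) (simp only: if_False)
  with assms show ?thesis by simp
qed

definition z_seq :: "nat \<Rightarrow> 'p::nontriv mod_ring \<times> 'q::nontriv mod_ring" where
  "z_seq n = (thue_morse n, of_nat n)"

definition phi :: "'p::nontriv mod_ring list \<Rightarrow> 'p mod_ring list" where
  "phi w = concat (map (\<lambda>a. map (\<lambda>j. a + of_nat j) [0..<CARD('p)]) w)"

lemma phi_letter: "phi [a] = map (\<lambda>j. a + of_nat j) [0..<CARD('p)]"
  for a :: "'p::nontriv mod_ring"
  by (simp add: phi_def)

definition zeta :: "nat \<Rightarrow> complex" where
  "zeta m = exp (2 * of_real pi * \<i> / of_nat m)"

end

theory Submission
  imports Defs
begin

text \<open>
  The blocks \<open>\<phi>(x)\<close> are permutations of the alphabet, so they all turn by the same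
  angle \<open>u = \<zeta>\<^sub>q\<^sup>k\<close>. Since \<open>t\<^sub>p\<close> is fixed by \<open>\<phi>\<close>, the \<open>m\<close>-th block of \<open>p\<close> steps of \<open>T\<close>
  contributes \<open>P\<^sub>T(\<phi>(t\<^sub>p(m)))\<close> rotated by \<open>u\<^sup>m\<close>, which only depends on \<open>m mod q\<close>.
  Hence \<open>T(p n) = B(n)\<close> for all \<open>n\<close>.
\<close>

lemma pi2_sum_list: "pi2 (sum_list ts) = prod_list (map pi2 ts)"
  by (induction ts) auto

text \<open>Offsets below \<open>CARD('p)\<close>, the characteristic of the ring, are pairwise
  incongruent.\<close>

lemma distinct_phi_letter: "distinct (phi [x])" for x :: "'p::nontriv mod_ring"
proof -
  have "inj_on (\<lambda>j. x + of_nat j) {..<CARD('p)}"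
    by (auto simp: inj_on_def of_nat_eq_iff_cong_CHAR cong_def)
  then show ?thesis
    by (simp add: phi_letter distinct_map atLeast0LessThan)
qed

lemma set_phi_letter: "set (phi [x]) = UNIV" for x :: "'p::nontriv mod_ring"
proof (rule card_subset_eq)
  show "card (set (phi [x])) = card (UNIV :: 'p mod_ring set)"
    using distinct_card[OF distinct_phi_letter, of x] by (simp add: phi_letter)
qed auto

text \<open>Angles multiply in a commutative group, so the order of letters is irrelevant. As
  \<open>x\<close> is absent on the right, an angle known for \<open>phi [0]\<close> holds for every
  block.\<close>

lemma word_angle_phi_letter: "word_angle T (phi [x]) = (\<Prod>a\<in>UNIV. pi2 (snd T a))"
  using prod.distinct_set_conv_list[OF distinct_phi_letter, of "\<lambda>a. pi2 (snd T a)" x]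
  by (simp add: word_angle_def word_sum_def pi2_sum_list set_phi_letter comp_def)

lemma map_thue_morse_phi:
  "map thue_morse [0..<CARD('p) * n] = phi (map (thue_morse :: nat \<Rightarrow> 'p::nontriv mod_ring) [0..<n])"
proof (induction n)
  case 0
  show ?case by (simp add: phi_def)
next
  case (Suc n)
  have "[0..<CARD('p) * Suc n] = [0..<CARD('p) * n] @ map (\<lambda>j. CARD('p) * n + j) [0..<CARD('p)]"
    using upt_add_eq_append[of 0 "CARD('p) * n" "CARD('p)"] map_add_upt[of "CARD('p) * n" "CARD('p)"]
    by (simp add: add.commute mult.commute)
  then show ?case
    using Suc by (simp add: phi_def thue_morse_rec)
qed

lemma curve_point_word_point: "curve_point T n = word_point T (map (fst T) [0..<n])"
  by (simp add: curve_point_def word_point_def word_sum_def comp_def)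

text \<open>Each block is rotated by the total angle of the blocks before it. Hence the induction
  appends letters at the end, where the prefix contributes the factor
  \<open>u ^ length w\<close>.\<close>

lemma word_sum_phi:
  assumes "\<And>x. word_angle T (phi [x]) = u"
  shows "pi1 (word_sum T (phi w)) = (\<Sum>m<length w. u ^ m * word_point T (phi [w ! m]))"
    and "pi2 (word_sum T (phi w)) = u ^ length w"
proof -
  have snoc: "word_sum T (phi (w @ [x])) = word_sum T (phi w) + word_sum T (phi [x])" for w x
    by (simp add: word_sum_def phi_def)
  show angle: "pi2 (word_sum T (phi w)) = u ^ length w" for w
    by (induction w rule: rev_induct)
       (use assms in \<open>simp_all add: snoc word_angle_def\<close>, simp add: word_sum_def phi_def)
  show "pi1 (word_sum T (phi w)) = (\<Sum>m<length w. u ^ m * word_point T (phi [w ! m]))"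
    by (induction w rule: rev_induct)
       (simp_all add: snoc angle word_point_def nth_append, simp add: word_sum_def phi_def)
qed

lemma curve_point_absolute_curve: "curve_point (absolute_curve \<sigma> \<kappa>) n = (\<Sum>m<n. \<kappa> (\<sigma> m))"
proof -
  \<comment> \<open>With no turning, no summand is rotated and \<open>pi1\<close> becomes
    additive.\<close>
  have "pi2 (\<Sum>i\<leftarrow>[0..<n]. turtle_of_complex (\<kappa> (\<sigma> i))) = 1" for n
    by (induction n) auto
  then show ?thesis
    by (induction n) (auto simp: curve_point_def absolute_curve_def)
qed

lemma to_int_mod_ring_of_nat:
  "to_int_mod_ring (of_nat n :: 'q::nontriv mod_ring) = int (n mod CARD('q))"
  by (simp add: of_nat_of_int_mod_ring of_int_mod_ring.rep_eq to_int_mod_ring.rep_eq zmod_int)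

lemma zeta_power_self: "m > 0 \<Longrightarrow> zeta m ^ m = 1"
  by (simp add: zeta_def flip: exp_of_nat_mult)

text \<open>Bridges the block rotation \<open>u ^ m\<close> and the exponent in
  \<open>\<kappa>\<close>, which sees only the representative of m in 0..q-1; they agree because
  \<open>u ^ q = 1\<close>.\<close>

lemma zeta_powi_mod:
  assumes "m > 0"
  shows "zeta m powi (k * int (n mod m)) = (zeta m powi k) ^ n"
proof -
  let ?u = "zeta m powi k"
  have "?u ^ m = 1"
    using zeta_power_self[OF assms] by (metis power_int_1_left power_int_commutes power_int_mult power_int_of_nat mult.commute)
  then have "?u ^ n = ?u ^ (n mod m)"
    by (metis div_mult_mod_eq mult.commute mult_1 power_add power_mult power_one)
  then show ?thesis
    by (simp add: power_int_mult)
qed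

theorem theorem3:
  fixes \<tau> :: "'p::nontriv mod_ring \<Rightarrow> turtle"
    and k :: int
    and T :: "'p mod_ring turtle_curve"
    and \<kappa> :: "'p mod_ring \<times> 'q::nontriv mod_ring \<Rightarrow> complex"
    and B :: "('p mod_ring \<times> 'q mod_ring) turtle_curve"
  assumes T: "T = (thue_morse, \<tau>)"
    and coprime: "coprime k (int CARD('q))"
    and angle: "word_angle T (phi [0]) = zeta CARD('q) powi k"
    and \<kappa>: "\<And>x y. \<kappa> (x, y) = word_point T (phi [x]) * zeta CARD('q) powi (k * to_int_mod_ring y)"
    and B: "B = absolute_curve z_seq \<kappa>"
  shows "similar T B"
proof -
  have "word_angle T (phi [x]) = zeta CARD('q) powi k" for x
    using angle by (simp add: word_angle_phi_letter)
  note block_sum = word_sum_phi(1)[OF this]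
  have "curve_point T (CARD('p) * n) = curve_point B n" for n
  proof -
    have "curve_point T (CARD('p) * n) = word_point T (phi (map thue_morse [0..<n]))"
      by (simp add: curve_point_word_point T map_thue_morse_phi)
    also have "\<dots> = (\<Sum>m<n. (zeta CARD('q) powi k) ^ m * word_point T (phi [thue_morse m]))"
      \<comment> \<open>Only the whole word is unfolded; the single blocks keep the form
        \<open>word_point\<close> used by \<open>\<kappa>\<close>.\<close>
      by (simp add: word_point_def[of T "phi (map thue_morse [0..<n])"] block_sum)
    also have "\<dots> = (\<Sum>m<n. \<kappa> (z_seq m))"
      by (simp add: z_seq_def \<kappa> to_int_mod_ring_of_nat zeta_powi_mod mult.commute)
    also have "\<dots> = curve_point B n"
      by (simp add: B curve_point_absolute_curve)
    finally show ?thesis .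
  qed
  then show ?thesis
    unfolding similar_def
    \<comment> \<open>One step of B is a block of p steps of T, with no rescaling.\<close>
    by (intro exI[of _ "CARD('p)"] exI[of _ "1::nat"] exI[of _ "1::complex"]) simp
qed

end
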